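(* $\displaystyle \max\{T_2(2):f\in\mathcal{T}\}=\frac54$, where for $f\in\mathcal{T}$, $f(z)=z+\sum_{n=2}^\infty a_nz^n$, one sets $T_2(2)=a_2^2-a_3^2$.
   Context: $\mathbb{D}=\{z\in\mathbb{C}:|z|<1\}$. $\mathcal{T}$ is the class of typically real functions: analytic functions $f$ in $\mathbb{D}$, normalized by $f(z)=z+\sum_{n=2}^\infty a_nz^n$, with $(\operatorname{Im} z)(\operatorname{Im} f(z))\ge0$ for $z\in\mathbb{D}$. By a theorem of Robertson, $f\in\mathcal{T}$ if and only if $f(z)=\int_{-1}^1\frac{z}{1-2tz+z^2}\,d\mu(t)$ for some probability measure $\mu$ on $[-1,1]$. In particular all coefficients $a_n$ are real. *)

theory Defs
  imports "HOL-Complex_Analysis.Complex_Analysis"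
begin

definition taylor_coeff :: "(complex \<Rightarrow> complex) \<Rightarrow> nat \<Rightarrow> complex" where
  "taylor_coeff f n = fps_nth (fps_expansion f 0) n"

text \<open>Functions are total, so a member of the class is only constrained on the unit disc.\<close>

definition typically_real :: "(complex \<Rightarrow> complex) set" where
  "typically_real =
     {f. f analytic_on ball 0 1 \<and> taylor_coeff f 0 = 0 \<and> taylor_coeff f 1 = 1 \<and>
         (\<forall>z\<in>ball 0 1. Im z * Im (f z) \<ge> 0)}"

text \<open>The second-order Toeplitz determinant with first row \<open>a\<^sub>2, a\<^sub>3\<close>. It is kept complex-valued
  because the coefficients are complex by type; on the class above they are real.\<close>

definition toeplitz_2_2 :: "(complex \<Rightarrow> complex) \<Rightarrow> complex" where
  "toeplitz_2_2 f = (taylor_coeff f 2)\<^sup>2 - (taylor_coeff f 3)\<^sup>2"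

lemma typically_real_power_series:
  assumes "f \<in> typically_real" "z \<in> ball 0 1"
  shows "(\<lambda>n. taylor_coeff f (n + 2) * z ^ (n + 2)) sums (f z - z)"
proof -
  have "f holomorphic_on ball 0 1"
    using assms(1) by (auto simp: typically_real_def analytic_imp_holomorphic)
  from holomorphic_power_series[OF this assms(2)]
  have "(\<lambda>n. taylor_coeff f n * z ^ n) sums f z"
    by (simp add: taylor_coeff_def fps_expansion_def)
  from sums_split_initial_segment[OF this, of 2] show ?thesis
    using assms(1) by (simp add: typically_real_def numeral_2_eq_2)
qed

end

theory Submission
  imports Defs
begin

text \<open>For \<open>f\<close> in the class and \<open>0 < r < 1\<close>, the density
  \<open>Im f(r e\<^sup>i\<^sup>\<theta>) sin \<theta>\<close> is nonnegative, and integrating it against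
  \<open>(cos \<theta> - c)\<^sup>2\<close> produces a nonnegative combination of \<open>r\<close>, \<open>a\<^sub>2 r\<^sup>2\<close>, \<open>a\<^sub>3 r\<^sup>3\<close>.
  Letting \<open>r \<rightarrow> 1\<close> and choosing \<open>c = a\<^sub>2 / 2\<close> gives \<open>a\<^sub>2\<^sup>2 \<le> a\<^sub>3 + 1\<close>, whence
  \<open>a\<^sub>2\<^sup>2 - a\<^sub>3\<^sup>2 \<le> 1 + a\<^sub>3 - a\<^sub>3\<^sup>2 \<le> 5/4\<close>. Equality holds for \<open>z / (1 - b z + z\<^sup>2)\<close> with
  \<open>b\<^sup>2 = 3/2\<close>, whose coefficients are \<open>a\<^sub>2 = b\<close> and \<open>a\<^sub>3 = b\<^sup>2 - 1\<close>.
  This bypasses Robertson's representation theorem.\<close>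

section \<open>Fourier integrals over circles inside the disc\<close>

text \<open>Cauchy's formula for the n-th derivative at 0, with the circle parametrized by its
  angle.\<close>

lemma has_integral_taylor_coeff_circle:
  assumes "f holomorphic_on ball 0 1" "0 < r" "r < 1"
  shows "((\<lambda>t. f (of_real r * cis t) * cis (- (real n * t))) has_integral
           of_real (2 * pi * r ^ n) * taylor_coeff f n) {0..2 * pi}"
proof -
  have sub: "cball 0 r \<subseteq> (ball 0 1 :: complex set)" "ball 0 r \<subseteq> (ball 0 1 :: complex set)"
    using assms by auto
  have "((\<lambda>u. f u / (u - 0) ^ Suc n) has_contour_integral
          (2 * pi * \<i>) / fact n * (deriv ^^ n) f 0) (circlepath 0 r)"
    using assms sub
    by (intro Cauchy_has_contour_integral_higher_derivative_circlepath)
       (auto intro: holomorphic_on_subset holomorphic_on_imp_continuous_on)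
  hence "((\<lambda>t. f (0 + r * cis t) / (0 + r * cis t - 0) ^ Suc n * r * \<i> * cis t) has_integral
          (2 * pi * \<i>) / fact n * (deriv ^^ n) f 0) {0..2 * pi}"
    unfolding circlepath_def by (subst (asm) has_contour_integral_part_circlepath_iff) auto
  \<comment> \<open>With u = r e^(it), du / u^(n+1) equals i r^(-n) e^(-int) dt. The factor removes
    \<open>\<i>\<close> and the power of r from the integrand and turns 2 pi i into 2 pi
    r^n.\<close>
  from has_integral_mult_right[OF this, of "- \<i> * of_real r ^ n"]
  have "((\<lambda>t. - \<i> * of_real r ^ n *
            (f (0 + r * cis t) / (0 + r * cis t - 0) ^ Suc n * r * \<i> * cis t)) has_integral
          of_real (2 * pi * r ^ n) * taylor_coeff f n) {0..2 * pi}"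
    by (simp add: taylor_coeff_def fps_expansion_def mult_ac)
  moreover have "- \<i> * of_real r ^ n *
      (f (0 + r * cis t) / (0 + r * cis t - 0) ^ Suc n * r * \<i> * cis t)
      = f (of_real r * cis t) * cis (- (real n * t))" for t
  proof -
    have "cis (- (real n * t)) = 1 / cis t ^ n"
      by (simp add: Complex.DeMoivre divide_inverse)
    thus ?thesis
      using assms by (simp add: field_simps)
  qed
  ultimately show ?thesis by simp
qed

text \<open>For n > 0 the function f(z) z^n vanishes at 0, so its mean over the circle is 0; this is
  the case of index 0 of the previous lemma.\<close>

lemma has_integral_positive_frequency_circle:
  assumes "f holomorphic_on ball 0 1" "0 < r" "r < 1" "n > 0"
  shows "((\<lambda>t. f (of_real r * cis t) * cis (real n * t)) has_integral 0) {0..2 * pi}"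
proof -
  have "(\<lambda>z. f z * z ^ n) holomorphic_on ball 0 1"
    by (intro holomorphic_intros assms)
  from has_integral_taylor_coeff_circle[OF this assms(2,3), of 0] assms(4)
  have "((\<lambda>t. f (of_real r * cis t) * (of_real r * cis t) ^ n) has_integral 0) {0..2 * pi}"
    by (simp add: taylor_coeff_def fps_expansion_def power_0_left)
  from has_integral_mult_right[OF this, of "1 / of_real r ^ n"] show ?thesis
    using assms(2) by (simp add: power_mult_distrib Complex.DeMoivre)
qed

text \<open>Since e^(-int) - e^(int) = -2i sin(nt) and Re(-2i w) = 2 Im w, the real part of the
  difference of the two preceding integrals isolates Im f.\<close>

lemma has_integral_Im_sin_circle:
  assumes "f holomorphic_on ball 0 1" "0 < r" "r < 1" "n > 0"
  shows "((\<lambda>t. Im (f (of_real r * cis t)) * sin (real n * t)) has_integral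
           pi * r ^ n * Re (taylor_coeff f n)) {0..2 * pi}"
proof -
  let ?F = "\<lambda>t. f (of_real r * cis t)"
  have "((\<lambda>t. ?F t * cis (- (real n * t)) - ?F t * cis (real n * t)) has_integral
          of_real (2 * pi * r ^ n) * taylor_coeff f n - 0) {0..2 * pi}"
    by (intro has_integral_diff has_integral_taylor_coeff_circle
        has_integral_positive_frequency_circle assms)
  from has_integral_linear[OF this bounded_linear_Re]
  have "((\<lambda>t. 2 * (Im (?F t) * sin (real n * t))) has_integral
          2 * (pi * r ^ n * Re (taylor_coeff f n))) {0..2 * pi}"
    by (simp add: o_def algebra_simps)
  from has_integral_mult_right[OF this, of "1 / 2"] show ?thesis
    by simp
qed

section \<open>Reality of the Taylor coefficients\<close>

text \<open>The complex derivative is also the limit along real increments. Those difference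
  quotients are real, and the reals are closed.\<close>

lemma deriv_real_on_real_axis:
  assumes holo: "f holomorphic_on A" and "open A"
    and real: "\<And>x. of_real x \<in> A \<Longrightarrow> f (of_real x) \<in> \<real>"
    and x: "of_real x \<in> A"
  shows "deriv f (of_real x) \<in> \<real>"
proof -
  have "(f has_field_derivative deriv f (of_real x)) (at (of_real x))"
    using holo \<open>open A\<close> x by (rule holomorphic_derivI)
  hence "((\<lambda>h. (f (of_real x + h) - f (of_real x)) / h) \<longlongrightarrow> deriv f (of_real x)) (at 0)"
    by (simp add: DERIV_def)
  moreover have "filterlim (of_real :: real \<Rightarrow> complex) (at 0) (at 0)"
    by (auto simp: filterlim_at intro!: tendsto_eq_intros eventually_neq_at_within)
  ultimately have lim: "((\<lambda>h::real. (f (of_real x + of_real h) - f (of_real x)) / of_real h)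
      \<longlongrightarrow> deriv f (of_real x)) (at 0)"
    by (rule filterlim_compose)
  have "((\<lambda>h::real. complex_of_real (x + h)) \<longlongrightarrow> of_real x) (at 0)"
    by (auto intro!: tendsto_eq_intros)
  hence "eventually (\<lambda>h::real. complex_of_real (x + h) \<in> A) (at 0)"
    using \<open>open A\<close> x by (rule topological_tendstoD)
  hence "eventually (\<lambda>h::real. (f (of_real x + of_real h) - f (of_real x)) / of_real h \<in> \<real>) (at 0)"
    by eventually_elim (use real x in \<open>auto intro!: Reals_divide Reals_diff simp flip: of_real_add\<close>)
  thus ?thesis
    by (intro Lim_in_closed_set[OF closed_complex_Reals _ _ lim]) auto
qed

lemma taylor_coeff_real:
  assumes "f holomorphic_on ball 0 1"
    and "\<And>x. complex_of_real x \<in> ball 0 1 \<Longrightarrow> f (of_real x) \<in> \<real>"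
  shows "taylor_coeff f n \<in> \<real>"
proof -
  \<comment> \<open>The induction covers the whole real diameter, because differentiating once more
    needs real values near the point and not only at 0.\<close>
  have "(deriv ^^ n) f (of_real x) \<in> \<real>" if "complex_of_real x \<in> ball 0 1" for x
    using that
  proof (induction n arbitrary: x)
    case (Suc n)
    show ?case
      using deriv_real_on_real_axis[OF holomorphic_higher_deriv[OF assms(1) open_ball] open_ball]
        Suc by simp
  qed (use assms in auto)
  from this[of 0] show ?thesis
    unfolding taylor_coeff_def fps_expansion_def fps_nth_Abs_fps
    by (intro Reals_divide) (simp_all add: fact_in_Reals)
qed

text \<open>The sign condition is vacuous on the real axis itself. Just above it Im f is nonnegative
  and just below nonpositive, so continuity along the vertical line through x forces Im f(x) =
  0.\<close>

lemma typically_real_real_axis: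
  assumes "f \<in> typically_real" "complex_of_real x \<in> ball 0 1"
  shows "f (of_real x) \<in> \<real>"
proof -
  have "f analytic_on {of_real x}"
    using assms by (auto simp: typically_real_def analytic_on_def)
  hence "isCont f (of_real x)"
    by (rule analytic_at_imp_isCont)
  moreover have line: "((\<lambda>h::real. of_real x + \<i> * of_real h) \<longlongrightarrow> of_real x) (at 0)"
    using tendsto_add[OF tendsto_const tendsto_mult[OF tendsto_const tendsto_of_real[OF tendsto_ident_at]],
        of "complex_of_real x" \<i> 0 UNIV] by simp
  ultimately have "((\<lambda>h::real. f (of_real x + \<i> * of_real h)) \<longlongrightarrow> f (of_real x)) (at 0)"
    by (rule isCont_tendsto_compose)
  hence lim: "((\<lambda>h::real. Im (f (of_real x + \<i> * of_real h))) \<longlongrightarrow> Im (f (of_real x))) (at 0)"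
    by (rule tendsto_Im)
  have "eventually (\<lambda>h::real. of_real x + \<i> * of_real h \<in> ball 0 1) (at 0)"
    using line open_ball assms(2) by (rule topological_tendstoD)
  hence ev: "eventually (\<lambda>h::real. h * Im (f (of_real x + \<i> * of_real h)) \<ge> 0) (at 0)"
  proof eventually_elim
    case (elim h)
    with assms(1) have "Im (of_real x + \<i> * of_real h) * Im (f (of_real x + \<i> * of_real h)) \<ge> 0"
      unfolding typically_real_def by blast
    thus ?case by simp
  qed
  have "eventually (\<lambda>h::real. Im (f (of_real x + \<i> * of_real h)) \<ge> 0) (at_right 0)"
    using filter_leD[OF at_le[OF subset_UNIV] ev] eventually_at_right_less[of 0]
    by eventually_elim (simp add: zero_le_mult_iff)
  hence "Im (f (of_real x)) \<ge> 0"
    by (rule tendsto_lowerbound[OF tendsto_mono[OF at_le[OF subset_UNIV] lim]]) simp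
  moreover have "eventually (\<lambda>h::real. h < 0) (at_left 0)"
    by (simp add: eventually_at_filter)
  hence "eventually (\<lambda>h::real. Im (f (of_real x + \<i> * of_real h)) \<le> 0) (at_left 0)"
    using filter_leD[OF at_le[OF subset_UNIV] ev]
    by eventually_elim (simp add: zero_le_mult_iff)
  hence "Im (f (of_real x)) \<le> 0"
    by (rule tendsto_upperbound[OF tendsto_mono[OF at_le[OF subset_UNIV] lim]]) simp
  ultimately show ?thesis by (simp add: complex_is_Real_iff)
qed

lemma typically_real_taylor_coeff_real:
  assumes "f \<in> typically_real"
  shows "taylor_coeff f n \<in> \<real>"
  using assms typically_real_real_axis[OF assms]
  by (intro taylor_coeff_real) (auto simp: typically_real_def analytic_imp_holomorphic)

section \<open>The inequality between the second and third coefficients\<close>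

lemma typically_real_coeff_ineq:
  assumes f: "f \<in> typically_real"
  shows "(Re (taylor_coeff f 2))\<^sup>2 \<le> Re (taylor_coeff f 3) + 1"
proof -
  have holo: "f holomorphic_on ball 0 1"
    using f by (auto simp: typically_real_def analytic_imp_holomorphic)
  define a b where "a = Re (taylor_coeff f 2)" and "b = Re (taylor_coeff f 3)"
  \<comment> \<open>This value minimizes \<open>4 * c\<^sup>2 - 4 * c * a\<close>, the part of the
    limiting inequality that depends on c; the minimum is -a^2.\<close>
  define c where "c = a / 2"
  have one: "Re (taylor_coeff f 1) = 1"
    using f by (simp add: typically_real_def)
  \<comment> \<open>The weights come from 4 sin t (cos t - c)^2 = sin 3t - 4c sin 2t + (4c^2 + 1)
    sin t.\<close>
  have ineq: "r ^ 3 * b - 4 * c * r\<^sup>2 * a + (4 * c\<^sup>2 + 1) * r \<ge> 0" if r: "0 < r" "r < 1" for r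
  proof -
    let ?u = "\<lambda>t. Im (f (of_real r * cis t))"
    have "((\<lambda>t. ?u t * sin (real 3 * t) - 4 * c * (?u t * sin (real 2 * t))
             + (4 * c\<^sup>2 + 1) * (?u t * sin (real 1 * t))) has_integral
           pi * r ^ 3 * b - 4 * c * (pi * r ^ 2 * a)
             + (4 * c\<^sup>2 + 1) * (pi * r ^ 1 * Re (taylor_coeff f 1))) {0..2 * pi}"
      unfolding a_def b_def
      by (intro has_integral_add has_integral_diff has_integral_mult_right
          has_integral_Im_sin_circle holo r) auto
    moreover have "?u t * sin (real 3 * t) - 4 * c * (?u t * sin (real 2 * t))
             + (4 * c\<^sup>2 + 1) * (?u t * sin (real 1 * t)) \<ge> 0" for t
    proof -
      have sin3: "sin (3 * t) = sin t * (4 * (cos t)\<^sup>2 - 1)"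
      proof -
        have "sin (3 * t) = sin (2 * t + t)" by simp
        also have "\<dots> = 2 * sin t * (cos t)\<^sup>2 + (2 * (cos t)\<^sup>2 - 1) * sin t"
          unfolding sin_add by (simp add: sin_double cos_double_cos power2_eq_square)
        finally show ?thesis by (simp add: algebra_simps)
      qed
      have "of_real r * cis t \<in> ball 0 1"
        using r by (simp add: norm_mult)
      hence "Im (of_real r * cis t) * ?u t \<ge> 0"
        using f unfolding typically_real_def by blast
      hence "?u t * sin t \<ge> 0"
        using r by (simp add: zero_le_mult_iff mult_ac)
      hence "0 \<le> (?u t * sin t) * (4 * (cos t - c)\<^sup>2)"
        by (rule mult_nonneg_nonneg) simp
      also have "\<dots> = ?u t * sin (real 3 * t) - 4 * c * (?u t * sin (real 2 * t))
             + (4 * c\<^sup>2 + 1) * (?u t * sin (real 1 * t))"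
        by (simp only: of_nat_numeral of_nat_1 mult_1 sin3 sin_double)
           (simp add: power2_eq_square algebra_simps)
      finally show ?thesis .
    qed
    ultimately have "0 \<le> pi * r ^ 3 * b - 4 * c * (pi * r ^ 2 * a)
             + (4 * c\<^sup>2 + 1) * (pi * r ^ 1 * Re (taylor_coeff f 1))"
      by (rule has_integral_nonneg)
    also have "\<dots> = pi * (r ^ 3 * b - 4 * c * r\<^sup>2 * a + (4 * c\<^sup>2 + 1) * r)"
      by (simp add: one[simplified] algebra_simps)
    finally show ?thesis
      using pi_gt_zero by (simp add: zero_le_mult_iff del: pi_gt_zero)
  qed
  have "((\<lambda>r. r ^ 3 * b - 4 * c * r\<^sup>2 * a + (4 * c\<^sup>2 + 1) * r) \<longlongrightarrow>
          1 ^ 3 * b - 4 * c * 1\<^sup>2 * a + (4 * c\<^sup>2 + 1) * 1) (at_left (1::real))"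
    by (intro tendsto_intros)
  moreover have "eventually (\<lambda>r. r ^ 3 * b - 4 * c * r\<^sup>2 * a + (4 * c\<^sup>2 + 1) * r \<ge> 0)
      (at_left (1::real))"
    using eventually_at_left_real[of 0 1] by (auto elim!: eventually_mono intro!: ineq)
  ultimately have "1 ^ 3 * b - 4 * c * 1\<^sup>2 * a + (4 * c\<^sup>2 + 1) * 1 \<ge> 0"
    by (rule tendsto_lowerbound) auto
  thus ?thesis
    by (simp add: c_def power2_eq_square flip: a_def b_def)
qed

section \<open>The extremal kernels\<close>

text \<open>Robertson's kernel with b = 2t; the range -1 \<le> t \<le> 1 becomes
  \<open>b\<^sup>2 \<le> 4\<close> below.\<close>

definition typically_real_kernel :: "real \<Rightarrow> complex \<Rightarrow> complex" where
  "typically_real_kernel b z = z / (1 - of_real b * z + z\<^sup>2)"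

text \<open>For such b both roots lie on the unit circle: a nonreal root has real part b/2, and then
  the real part of the equation gives modulus 1; a real root forces b^2 = 4 and is 1 or -1.\<close>

lemma kernel_denominator_nonzero:
  fixes z :: complex
  assumes "b\<^sup>2 \<le> 4" "z \<in> ball 0 1"
  shows "1 - of_real b * z + z\<^sup>2 \<noteq> 0"
proof
  assume eq: "1 - of_real b * z + z\<^sup>2 = 0"
  define x y where "x = Re z" and "y = Im z"
  have re: "1 - b * x + x\<^sup>2 - y\<^sup>2 = 0" and im: "y * (2 * x - b) = 0"
    using arg_cong[OF eq, of Re] arg_cong[OF eq, of Im]
    by (simp_all add: x_def y_def power2_eq_square algebra_simps)
  have less: "x\<^sup>2 + y\<^sup>2 < 1"
    using assms(2) by (simp add: x_def y_def cmod_def)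
  show False
  proof (cases "y = 0")
    case True
    have "(2 * x - b)\<^sup>2 = b\<^sup>2 - 4"
      using re True by (simp add: power2_eq_square algebra_simps)
    hence "2 * x = b" "b\<^sup>2 = 4"
      using assms(1) zero_le_power2[of "2 * x - b"] by auto
    hence "x\<^sup>2 = 1"
      by (auto simp: power_mult_distrib)
    thus False using less by simp
  next
    case False
    hence "b = 2 * x" using im by simp
    thus False using re less by (simp add: power2_eq_square)
  qed
qed

lemma kernel_holomorphic:
  assumes "b\<^sup>2 \<le> 4"
  shows "typically_real_kernel b holomorphic_on ball 0 1"
  unfolding typically_real_kernel_def
  by (intro holomorphic_intros kernel_denominator_nonzero assms)

text \<open>Clearing the denominator gives F (1 - bX + X^2) = X for the expansion F, hence the
  recurrence a_n = b a_(n-1) - a_(n-2) for n \<ge> 2.\<close>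

lemma kernel_taylor_coeffs:
  assumes "b\<^sup>2 \<le> 4"
  shows "taylor_coeff (typically_real_kernel b) 0 = 0"
    and "taylor_coeff (typically_real_kernel b) 1 = 1"
    and "taylor_coeff (typically_real_kernel b) 2 = of_real b"
    and "taylor_coeff (typically_real_kernel b) 3 = of_real b ^ 2 - 1"
proof -
  define F where "F = fps_expansion (typically_real_kernel b) 0"
  have "typically_real_kernel b has_fps_expansion F"
    unfolding F_def using kernel_holomorphic[OF assms]
    by (intro has_fps_expansion_fps_expansion[of "ball 0 1"]) auto
  hence "(\<lambda>z. typically_real_kernel b z * (1 - of_real b * z + z ^ 2))
      has_fps_expansion F * (1 - fps_const (of_real b) * fps_X + fps_X ^ 2)"
    by (intro fps_expansion_intros)
  \<comment> \<open>Only local: at a zero of the denominator division yields 0, so the product there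
    is 0 and not z.\<close>
  moreover have ev: "eventually
      (\<lambda>z. typically_real_kernel b z * (1 - of_real b * z + z ^ 2) = z) (nhds 0)"
  proof -
    have "eventually (\<lambda>z::complex. z \<in> ball 0 1) (nhds 0)"
      by (intro eventually_nhds_in_open) auto
    thus ?thesis
      by eventually_elim
        (use kernel_denominator_nonzero[OF assms] in \<open>simp add: typically_real_kernel_def\<close>)
  qed
  ultimately have "(\<lambda>z. z) has_fps_expansion F * (1 - fps_const (of_real b) * fps_X + fps_X ^ 2)"
    using has_fps_expansion_cong[OF ev refl] by (simp only:)
  hence eq: "F * (1 - fps_const (of_real b) * fps_X + fps_X ^ 2) = fps_X"
    using fps_expansion_unique_complex has_fps_expansion_fps_X by blast
  have rec: "fps_nth F n - of_real b * (if n = 0 then 0 else fps_nth F (n - 1))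
      + (if n < 2 then 0 else fps_nth F (n - 2)) = (if n = 1 then 1 else 0)" for n
  proof -
    have "F * (1 - fps_const (of_real b) * fps_X + fps_X ^ 2)
        = F - fps_const (of_real b) * (F * fps_X) + F * fps_X ^ 2"
      by (simp add: algebra_simps)
    from arg_cong[OF this[symmetric], of "\<lambda>G. fps_nth G n"] show ?thesis
      unfolding eq by (simp add: fps_X_power_mult_right_nth fps_X_nth)
  qed
  have F0: "fps_nth F 0 = 0" using rec[of 0] by simp
  have F1: "fps_nth F 1 = 1" using rec[of 1] F0 by simp
  have F2: "fps_nth F 2 = of_real b" using rec[of 2] F0 F1 by simp
  have F3: "fps_nth F 3 = of_real b ^ 2 - 1"
    using rec[of 3] F1 F2 by (simp add: power2_eq_square algebra_simps)
  show "taylor_coeff (typically_real_kernel b) 0 = 0"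
    "taylor_coeff (typically_real_kernel b) 1 = 1"
    "taylor_coeff (typically_real_kernel b) 2 = of_real b"
    "taylor_coeff (typically_real_kernel b) 3 = of_real b ^ 2 - 1"
    using F0 F1 F2 F3 by (simp_all add: taylor_coeff_def F_def)
qed

text \<open>With D the denominator, z cnj(D) = z - b |z|^2 + |z|^2 cnj(z). The middle term is real,
  so the imaginary part is Im z (1 - |z|^2), which has the sign of Im z in the disc.\<close>

lemma kernel_typically_real:
  assumes "b\<^sup>2 \<le> 4"
  shows "typically_real_kernel b \<in> typically_real"
proof -
  have "Im z * Im (typically_real_kernel b z) \<ge> 0" if z: "z \<in> ball 0 1" for z
  proof -
    have le: "(Re z)\<^sup>2 + (Im z)\<^sup>2 \<le> 1"
      using z by (simp add: cmod_def)
    let ?D = "1 - of_real b * z + z\<^sup>2"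
    have "Im (typically_real_kernel b z) = Im (z * cnj ?D) / (cmod ?D)\<^sup>2"
      by (simp add: typically_real_kernel_def complex_div_cnj[of z] 
          flip: of_real_power)
    also have "Im (z * cnj ?D) = Im z * (1 - ((Re z)\<^sup>2 + (Im z)\<^sup>2))"
      by (simp add: power2_eq_square algebra_simps)
    finally have "Im z * Im (typically_real_kernel b z)
        = (Im z)\<^sup>2 * (1 - ((Re z)\<^sup>2 + (Im z)\<^sup>2)) / (cmod ?D)\<^sup>2"
      by (simp add: power2_eq_square)
    thus ?thesis using le by simp
  qed
  thus ?thesis
    using kernel_taylor_coeffs[OF assms] kernel_holomorphic[OF assms]
    by (simp add: typically_real_def analytic_on_open)
qed

theorem theorem2p8:
  shows "(\<forall>f\<in>typically_real. toeplitz_2_2 f \<in> \<real> \<and> Re (toeplitz_2_2 f) \<le> 5 / 4) \<and>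
         (\<exists>f\<in>typically_real. toeplitz_2_2 f = 5 / 4)"
proof (intro conjI ballI)
  fix f assume f: "f \<in> typically_real"
  note real = typically_real_taylor_coeff_real[OF f]
  show "toeplitz_2_2 f \<in> \<real>"
    unfolding toeplitz_2_2_def by (intro Reals_diff Reals_power real)
  define a b where "a = Re (taylor_coeff f 2)" and "b = Re (taylor_coeff f 3)"
  have "taylor_coeff f 2 = of_real a" "taylor_coeff f 3 = of_real b"
    using real by (auto simp: a_def b_def)
  hence "Re (toeplitz_2_2 f) = a\<^sup>2 - b\<^sup>2"
    by (simp add: toeplitz_2_2_def flip: of_real_power)
  \<comment> \<open>Insert a^2 \<le> b + 1 and complete the square in b.\<close>
  also have "\<dots> \<le> 5 / 4 - (b - 1 / 2)\<^sup>2"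
    using typically_real_coeff_ineq[OF f]
    by (simp add: a_def b_def power2_eq_square algebra_simps)
  finally show "Re (toeplitz_2_2 f) \<le> 5 / 4"
    using zero_le_power2[of "b - 1 / 2"] by linarith
next
  \<comment> \<open>Equality needs a_3 = 1/2 and a_2^2 = a_3 + 1. Every kernel satisfies the second
    condition, and the first reads b^2 - 1 = 1/2.\<close>
  define b :: real where "b = sqrt (3 / 2)"
  have b2: "b\<^sup>2 = 3 / 2" by (simp add: b_def)
  have c: "complex_of_real b ^ 2 = 3 / 2"
    using arg_cong[OF b2, of complex_of_real] by simp
  have "b\<^sup>2 \<le> 4" using b2 by simp
  hence "toeplitz_2_2 (typically_real_kernel b) = 5 / 4"
    by (simp add: toeplitz_2_2_def kernel_taylor_coeffs c power2_eq_square[of "1 / 2"])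
  thus "\<exists>f\<in>typically_real. toeplitz_2_2 f = 5 / 4"
    using kernel_typically_real[OF \<open>b\<^sup>2 \<le> 4\<close>] by blast
qed

end
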